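(* Assume that $\rho$ is a radially symmetric probability measure on $\mathbb{R}^d$, $\rho=\rho(r)\,dr\,d\theta$ in polar coordinates. Let $\tilde\gamma$ be a minimizer of the reduced problem $$\min_{\gamma}\int_{\mathbb{R}^N} h(r_1,\dots,r_N)\,d\gamma$$ among measures $\gamma$ on $\mathbb{R}^N$ whose $N$ one-dimensional marginals all equal $\mu:=\rho(r)\,dr$ (a measure on $[0,\infty)$), where $h(r_1,\dots,r_N)=\inf_{|x_1|=r_1,\dots,|x_N|=r_N}\sum_{i\ne j}\frac1{|x_i-x_j|}$. Let $\rho_N$ be the measure on $(\mathbb{R}^d)^N$ given in polar coordinates by $$\rho_N=\tilde\gamma(r_1,\dots,r_N)\otimes\gamma^{r_1,\dots,r_N}(\theta_1,\dots,\theta_N),$$ i.e. $\rho_N$ has law $\tilde\gamma$ for the radii $(|x_1|,\dots,|x_N|)$ and conditional law $\gamma^{r_1,\dots,r_N}$ (defined in the context) given $|x_i|=r_i$ for all $i$. Then $\rho_N$ is optimal for the problem of minimizing $C_N$ over $\Pi(\rho)$, that is, $\rho_N$ attains the infimum $E_N[\rho]$.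
   Context: For a probability measure $\rho$ on $\mathbb{R}^d$, $\Pi(\rho)$ is the set of probability measures on $(\mathbb{R}^{d})^N$ all of whose $N$ marginals on $\mathbb{R}^d$ equal $\rho$. For $\rho_N\in\Pi(\rho)$, $$C_N(\rho_N)=\int_{\mathbb{R}^{dN}}\sum_{i\ne j}\frac{1}{|x_i-x_j|}\,d\rho_N,\qquad E_N[\rho]=\inf_{\rho_N\in\Pi(\rho)}C_N(\rho_N),$$ where the integrand is $+\infty$ when $x_i=x_j$ for some $i\neq j$. Polar coordinates identify $\mathbb{R}^d$ with $[0,\infty)\times\mathbb{S}^{d-1}$, $d\theta$ is the uniform measure on $\mathbb{S}^{d-1}$ (normalized, so that $\mu$ is a probability measure), and radial symmetry of $\rho=\rho(r,\theta)\,dr\,d\theta$ means that the density $\rho(r,\theta)=\rho(r)$ is independent of $\theta$. For each fixed $\vec r=(r_1,\dots,r_N)$, fix a point $(x_1,\dots,x_N)=(x_1(\vec r),\dots,x_N(\vec r))$ with $|x_i|=r_i$ attaining the infimum defining $h(\vec r)$. Let $S_{r_i}=\{x\in\mathbb{R}^d:|x|=r_i\}$, let $\nu$ be the (normalized) Haar measure on the rotation group $SO(d)$, and let $\gamma^{r_1,\dots,r_N}=G_{\#}\nu$ be the push-forward of $\nu$ by $G:SO(d)\to S_{r_1}\times\dots\times S_{r_N}$, $G(A)=(A x_1,\dots,A x_N)$.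
   Formalization: The dimension is assumed to be d ≥ 2 (for d = 1 the group SO(1) is trivial and ρ_N may fail to have marginals ρ), and the map r ↦ γ^{r_1,…,r_N} is assumed measurable up to γ̃-null sets, so that ρ_N is defined. *)

theory Defs
  imports "HOL-Probability.Probability"
begin

text \<open>Points of $(\mathbb{R}^d)^N$ have type \<^typ>\<open>real^'d^'n\<close>, with $d$ = \<open>CARD('d)\<close>
  and $N$ = \<open>CARD('n)\<close>; \<open>x $ i\<close> is the $i$-th particle.\<close>

definition couplings :: "'a::topological_space measure \<Rightarrow> ('a^'n::finite) measure set" where
  "couplings \<rho> = {P. prob_space P \<and> sets P = sets borel \<and> (\<forall>i. distr P borel (\<lambda>x. x $ i) = \<rho>)}"

text \<open>The sum runs over ordered pairs. In \<^typ>\<open>ennreal\<close> one has \<open>1 / 0 = \<infinity>\<close>, so the cost is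
  infinite as soon as two particles coincide.\<close>

definition coulomb_cost :: "real^'d::finite^'n::finite \<Rightarrow> ennreal" where
  "coulomb_cost x = (\<Sum>(i, j) | i \<noteq> j. 1 / ennreal (norm (x $ i - x $ j)))"

definition total_cost :: "(real^'d::finite^'n::finite) measure \<Rightarrow> ennreal" where
  "total_cost P = (\<integral>\<^sup>+ x. coulomb_cost x \<partial>P)"

text \<open>The type argument fixes the index type of the particles, that is $N$.\<close>

definition optimal_cost :: "'n::finite itself \<Rightarrow> (real^'d::finite) measure \<Rightarrow> ennreal" where
  "optimal_cost _ \<rho> = (INF P \<in> (couplings \<rho> :: (real^'d^'n) measure set). total_cost P)"

text \<open>The type argument fixes $d$. If some radius is negative, the infimum is over the empty set
  and hence \<open>\<infinity>\<close>; such radii are null for all couplings of a measure on $[0,\infty)$.\<close>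

definition reduced_cost :: "'d::finite itself \<Rightarrow> real^'n::finite \<Rightarrow> ennreal" where
  "reduced_cost _ r = (INF x \<in> {x :: real^'d^'n. \<forall>i. norm (x $ i) = r $ i}. coulomb_cost x)"

text \<open>The normalized surface measure of the unit sphere, as the cone measure: the mass of a
  set \<open>B\<close> of directions is the proportion of the unit ball lying in the cone over \<open>B\<close>.\<close>

definition sphere_measure :: "(real^'d::finite) measure" where
  "sphere_measure = distr (uniform_measure lborel (ball 0 1)) borel (\<lambda>x. x /\<^sub>R norm x)"

definition radial_law :: "(real \<Rightarrow> ennreal) \<Rightarrow> real measure" where
  "radial_law f = density lborel (\<lambda>r. f r * indicator {0..} r)"

text \<open>The measure $f(r)\,dr\,d\theta$; there is no Jacobian factor $r^{d-1}$.\<close>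

definition polar_measure :: "(real \<Rightarrow> ennreal) \<Rightarrow> (real^'d::finite) measure" where
  "polar_measure f = distr (radial_law f \<Otimes>\<^sub>M sphere_measure) borel (\<lambda>(r, \<theta>). r *\<^sub>R \<theta>)"

definition SO :: "(real^'d::finite^'d) set" where
  "SO = {A. rotation_matrix A}"

definition normalized_haar_SO :: "(real^'d::finite^'d) measure \<Rightarrow> bool" where
  "normalized_haar_SO \<nu> \<longleftrightarrow>
     prob_space \<nu> \<and> sets \<nu> = sets (restrict_space borel SO) \<and>
     (\<forall>B\<in>SO. distr \<nu> \<nu> (\<lambda>A. B ** A) = \<nu>)"

definition rotation_law ::
    "(real^'d::finite^'d) measure \<Rightarrow> real^'d^'n::finite \<Rightarrow> (real^'d^'n) measure" where
  "rotation_law \<nu> x = distr \<nu> borel (\<lambda>A. \<chi> i. A *v (x $ i))"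

end

theory Submission
  imports Defs
begin

text \<open>Pushing a coupling of \<open>\<rho>\<close> forward to the radii gives a coupling of the radial law, and its
  reduced cost is at most the original cost; hence the reduced minimum is a lower bound. Conversely
  the cost is rotation invariant, so \<open>\<rho>\<^sub>N\<close> attains this bound. That \<open>\<rho>\<^sub>N\<close> has the right marginals
  amounts to the orbit of a point under the Haar measure being uniform on its sphere.\<close>

subsection \<open>Rotation invariance of the sphere measure\<close>

lemma nn_integral_lborel_shift:
  fixes g :: "'a::euclidean_space \<Rightarrow> ennreal"
  assumes [measurable]: "g \<in> borel_measurable borel"
  shows "(\<integral>\<^sup>+x. g (c + x) \<partial>lborel) = (\<integral>\<^sup>+x. g x \<partial>lborel)"
proof -
  have "(\<integral>\<^sup>+x. g x \<partial>lborel) = (\<integral>\<^sup>+x. g x \<partial>distr lborel borel ((+) c))"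
    by (simp add: lborel_distr_plus)
  also have "\<dots> = (\<integral>\<^sup>+x. g (c + x) \<partial>lborel)"
    by (subst nn_integral_distr) auto
  finally show ?thesis ..
qed

text \<open>The volume of the ball will be cancelled as a factor and divided by, so it has to be
  positive and finite.\<close>

lemma emeasure_lborel_unit_ball:
  "emeasure lborel (ball (0::'a::euclidean_space) 1) \<noteq> 0"
  "emeasure lborel (ball (0::'a::euclidean_space) 1) < top"
  using emeasure_lborel_ball_finite[of "0::'a" 1] unit_ball_vol_pos[of "real DIM('a)"]
  by (auto simp: emeasure_ball simp del: unit_ball_vol_pos)

lemma orthogonal_transformation_measurable:
  fixes T :: "'a::euclidean_space \<Rightarrow> 'a"
  assumes "orthogonal_transformation T"
  shows "T \<in> borel_measurable borel"
  using assms by (intro borel_measurable_continuous_onI linear_continuous_on linear_linear[THEN iffD2])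
     (auto simp: linear_conv_bounded_linear[symmetric] orthogonal_transformation_linear)

text \<open>The change-of-variables lemmas of the library assume a well-ordered index type. Here
  invariance comes from the uniqueness of a translation-invariant measure: both sides are compared
  through the double integral of the indicator of \<open>y - T x \<in> B \<and> T x \<in> E\<close>, where \<open>B\<close> is the unit
  ball.\<close>

lemma lborel_distr_orthogonal:
  fixes T :: "'a::euclidean_space \<Rightarrow> 'a"
  assumes T: "orthogonal_transformation T"
  shows "distr lborel borel T = lborel"
proof (rule measure_eqI)
  note [measurable] = orthogonal_transformation_measurable[OF T]
  have lin: "T (a + b) = T a + T b" "T (a - b) = T a - T b" for a b
    using T by (simp_all add: orthogonal_transformation_linear linear_add linear_diff)
  have nT: "norm (T a) = norm a" for a
    using T by (simp add: orthogonal_transformation_norm)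
  fix E assume "E \<in> sets (distr lborel borel T)"
  then have [measurable]: "E \<in> sets borel" by simp
  let ?B = "ball (0::'a) 1"
  define b :: "'a \<Rightarrow> ennreal" where "b = indicator ?B"
  have [measurable]: "b \<in> borel_measurable borel"
    unfolding b_def by (intro borel_measurable_indicator borel_open open_ball)
  have int_b: "(\<integral>\<^sup>+x. b x \<partial>lborel) = emeasure lborel ?B"
    unfolding b_def by (rule nn_integral_indicator) simp
  let ?e = "indicator E :: 'a \<Rightarrow> ennreal"
  have "emeasure lborel ?B * emeasure (distr lborel borel T) E
      = (\<integral>\<^sup>+x. ?e (T x) * (\<integral>\<^sup>+y. b y \<partial>lborel) \<partial>lborel)"
  proof -
    have "emeasure (distr lborel borel T) E = (\<integral>\<^sup>+x. ?e x \<partial>distr lborel borel T)"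
      by simp
    also have "\<dots> = (\<integral>\<^sup>+x. ?e (T x) \<partial>lborel)"
      by (rule nn_integral_distr) auto
    finally show ?thesis
      by (simp add: b_def nn_integral_multc mult.commute)
  qed
  \<comment> \<open>Translation invariance replaces the integral of \<open>b\<close> by the integral
    of its translate by \<open>T x\<close>, which couples the two variables.\<close>
  also have "\<dots> = (\<integral>\<^sup>+x. \<integral>\<^sup>+y. ?e (T x) * b (- T x + y) \<partial>lborel \<partial>lborel)"
  proof (rule nn_integral_cong)
    fix x
    have "(\<integral>\<^sup>+y. ?e (T x) * b (- T x + y) \<partial>lborel) = ?e (T x) * (\<integral>\<^sup>+y. b (- T x + y) \<partial>lborel)"
      by (rule nn_integral_cmult) measurable
    also have "(\<integral>\<^sup>+y. b (- T x + y) \<partial>lborel) = (\<integral>\<^sup>+y. b y \<partial>lborel)"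
      by (rule nn_integral_lborel_shift) measurable
    finally show "?e (T x) * (\<integral>\<^sup>+y. b y \<partial>lborel) = (\<integral>\<^sup>+y. ?e (T x) * b (- T x + y) \<partial>lborel)" ..
  qed
  also have "\<dots> = (\<integral>\<^sup>+y. \<integral>\<^sup>+x. ?e (T x) * b (- T x + y) \<partial>lborel \<partial>lborel)"
    by (rule lborel_pair.Fubini') measurable
  also have "\<dots> = (\<integral>\<^sup>+y. \<integral>\<^sup>+x. ?e (y + T x) * b x \<partial>lborel \<partial>lborel)"
  proof (rule nn_integral_cong)
    fix y
    \<comment> \<open>\<open>T\<close> is onto, so shifting \<open>x\<close> by a preimage
      \<open>w\<close> of \<open>y\<close> turns \<open>T x\<close> into \<open>y + T x\<close> and
      cancels \<open>y\<close> in the argument of \<open>b\<close>.\<close>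
    obtain w where w: "y = T w"
      using T by (metis orthogonal_transformation_surj surjD)
    have "(\<integral>\<^sup>+x. ?e (T x) * b (- T x + y) \<partial>lborel)
        = (\<integral>\<^sup>+x. ?e (T (w + x)) * b (- T (w + x) + y) \<partial>lborel)"
      by (rule nn_integral_lborel_shift[symmetric]) measurable
    also have "\<dots> = (\<integral>\<^sup>+x. ?e (y + T x) * b x \<partial>lborel)"
      \<comment> \<open>What remains is \<open>b (- T x) = b x\<close>: the ball is symmetric and
        \<open>T\<close> preserves the norm.\<close>
      by (intro nn_integral_cong arg_cong2[where f="(*)"]) (auto simp: b_def w lin nT indicator_def)
    finally show "(\<integral>\<^sup>+x. ?e (T x) * b (- T x + y) \<partial>lborel) = \<dots>" .
  qed
  also have "\<dots> = (\<integral>\<^sup>+x. \<integral>\<^sup>+y. ?e (y + T x) * b x \<partial>lborel \<partial>lborel)"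
    by (rule lborel_pair.Fubini') measurable
  \<comment> \<open>For fixed \<open>x\<close> the shift by \<open>T x\<close> disappears under the
    integral over \<open>y\<close>, and with it the last trace of \<open>T\<close>.\<close>
  also have "\<dots> = (\<integral>\<^sup>+x. emeasure lborel E * b x \<partial>lborel)"
    using nn_integral_lborel_shift[of ?e] by (simp add: nn_integral_multc add.commute[of _ "T _"])
  also have "\<dots> = emeasure lborel ?B * emeasure lborel E"
    by (subst nn_integral_cmult) (simp_all add: int_b mult.commute)
  finally show "emeasure (distr lborel borel T) E = emeasure lborel E"
    by (subst (asm) ennreal_mult_cancel_left) (use emeasure_lborel_unit_ball[where 'a='a] in auto)
qed simp

section \<open>The normalized measure on the unit sphere\<close>

lemma prob_space_sphere_measure: "prob_space (sphere_measure :: (real^'d::finite) measure)"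
proof -
  interpret prob_space "uniform_measure lborel (ball (0::real^'d) 1)"
    using emeasure_lborel_unit_ball[where 'a="real^'d"] by (intro prob_space_uniform_measure) auto
  show ?thesis
    unfolding sphere_measure_def by (rule prob_space_distr) measurable
qed

lemma sets_sphere_measure[simp, measurable_cong]: "sets sphere_measure = sets borel"
  by (simp add: sphere_measure_def)

lemma space_sphere_measure[simp]: "space sphere_measure = UNIV"
  by (simp add: sphere_measure_def)

text \<open>Normalization takes every nonzero point of the ball to the sphere. The origin, which it
  leaves at \<open>0\<close> by the convention \<open>inverse 0 = 0\<close>, is a null set.\<close>

lemma AE_sphere_measure_norm: "AE \<theta> in (sphere_measure :: (real^'d::finite) measure). norm \<theta> = 1"
proof -
  have "AE z in uniform_measure lborel (ball (0::real^'d) 1). z \<noteq> 0"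
    using AE_lborel_singleton[of "0::real^'d"] by (subst AE_uniform_measure) (auto simp: emeasure_lborel_unit_ball)
  then have "AE z in uniform_measure lborel (ball (0::real^'d) 1). norm (z /\<^sub>R norm z) = 1"
    by eventually_elim simp
  then show ?thesis
    unfolding sphere_measure_def by (subst AE_distr_iff) auto
qed

text \<open>\<open>T\<close> preserves Lebesgue measure and the unit ball, hence the uniform measure
  on the ball; being linear and isometric, it also commutes with normalization.\<close>

lemma sphere_measure_distr_orthogonal:
  fixes T :: "real^'d::finite \<Rightarrow> real^'d"
  assumes T: "orthogonal_transformation T"
  shows "distr sphere_measure borel T = sphere_measure"
proof -
  note [measurable] = orthogonal_transformation_measurable[OF T]
  let ?U = "uniform_measure lborel (ball (0::real^'d) 1)"
  let ?n = "\<lambda>z::real^'d. z /\<^sub>R norm z"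
  have nT: "norm (T a) = norm a" for a
    using T by (simp add: orthogonal_transformation_norm)
  have U: "distr ?U borel T = ?U"
  proof (rule measure_eqI)
    fix E assume "E \<in> sets (distr ?U borel T)"
    then have [measurable]: "E \<in> sets borel" by simp
    have "emeasure (distr ?U borel T) E = emeasure ?U (T -` E)"
      by (subst emeasure_distr) auto
    also have "\<dots> = emeasure lborel (ball 0 1 \<inter> T -` E) / emeasure lborel (ball (0::real^'d) 1)"
      by (subst emeasure_uniform_measure) (auto intro!: measurable_sets_borel[of _ borel])
    also have "ball 0 1 \<inter> T -` E = T -` (ball 0 1 \<inter> E)"
      by (auto simp: nT)
    also have "emeasure lborel (T -` (ball 0 1 \<inter> E)) = emeasure (distr lborel borel T) (ball 0 1 \<inter> E)"
      by (subst emeasure_distr) auto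
    also have "\<dots> / emeasure lborel (ball (0::real^'d) 1) = emeasure ?U E"
      by (simp add: lborel_distr_orthogonal[OF T])
    finally show "emeasure (distr ?U borel T) E = emeasure ?U E" .
  qed simp
  have "distr sphere_measure borel T = distr ?U borel (T \<circ> ?n)"
    unfolding sphere_measure_def by (rule distr_distr) measurable
  also have "T \<circ> ?n = ?n \<circ> T"
    using T by (auto simp: fun_eq_iff nT orthogonal_transformation_linear linear_cmul)
  also have "distr ?U borel (?n \<circ> T) = distr (distr ?U borel T) borel ?n"
    by (rule distr_distr[symmetric]) measurable
  finally show ?thesis
    by (simp add: U sphere_measure_def)
qed

subsection \<open>The Haar measure acting on a sphere\<close>

lemma SO_orthogonal: "A \<in> SO \<Longrightarrow> orthogonal_matrix A"
  by (simp add: SO_def rotation_matrix_def)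

lemma SO_transpose: "A \<in> SO \<Longrightarrow> transpose A \<in> SO"
  by (simp add: SO_def rotation_matrix_def)

lemma SO_orthogonal_transformation:
  "A \<in> SO \<Longrightarrow> orthogonal_transformation ((*v) A)"
  by (simp add: orthogonal_transformation_matrix SO_orthogonal)

text \<open>In dimension one \<open>SO\<close> is trivial and cannot exchange a point and its
  negative; this is where the bound on the dimension enters.\<close>

lemma SO_transitive:
  fixes a b :: "real^'d::finite"
  assumes "CARD('d) \<ge> 2" "norm a = norm b"
  obtains A where "A \<in> SO" "A *v a = b"
proof -
  obtain g :: "real^'d \<Rightarrow> real^'d"
    where g: "orthogonal_transformation g" "det (matrix g) = 1" "g a = b"
    using rotation_exists[OF assms] .
  show thesis
  proof
    show "matrix g \<in> SO"
      using g by (simp add: SO_def rotation_matrix_def orthogonal_transformation_matrix)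
    show "matrix g *v a = b"
      using g by (simp add: matrix_works orthogonal_transformation_linear)
  qed
qed

lemma matrix_vector_mult_measurable[measurable]:
  fixes g :: "'a \<Rightarrow> real^'m::finite^'n::finite"
  assumes "g \<in> borel_measurable M" "h \<in> borel_measurable M"
  shows "(\<lambda>x. g x *v h x) \<in> borel_measurable M"
proof (rule borel_measurable_continuous_Pair[OF assms])
  show "continuous_on UNIV (\<lambda>p::(real^'m^'n) \<times> (real^'m). fst p *v snd p)"
    unfolding matrix_vector_mult_def by (intro continuous_intros)
qed

lemma transpose_measurable[measurable]:
  "(transpose :: real^'m::finite^'n::finite \<Rightarrow> _) \<in> borel_measurable borel"
  unfolding transpose_def by (intro borel_measurable_continuous_onI continuous_intros)

lemma vec_nth_measurable[measurable]:
  "(\<lambda>x::'a::second_countable_topology^'n::finite. x $ i) \<in> borel_measurable borel"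
  by (intro borel_measurable_continuous_onI continuous_intros)

lemma normalized_haar_SO_space: "normalized_haar_SO \<nu> \<Longrightarrow> space \<nu> = SO"
  unfolding normalized_haar_SO_def by (auto dest: sets_eq_imp_space_eq simp: space_restrict_space)

lemma normalized_haar_SO_measurable:
  assumes "normalized_haar_SO \<nu>" "g \<in> borel \<rightarrow>\<^sub>M N"
  shows "g \<in> \<nu> \<rightarrow>\<^sub>M N"
  using assms measurable_restrict_space1[OF assms(2)] measurable_cong_sets[of \<nu> "restrict_space borel SO" N N]
  unfolding normalized_haar_SO_def by blast

text \<open>Left invariance in the form needed under iterated integrals. Since \<open>SO\<close> is
  closed under products, left multiplication is measurable from \<open>\<nu>\<close> to itself, and
  the integral of the push-forward can be unfolded.\<close>

lemma normalized_haar_SO_invariant: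
  assumes haar: "normalized_haar_SO \<nu>" and B: "B \<in> SO" and g: "g \<in> borel_measurable borel"
  shows "(\<integral>\<^sup>+A. g (B ** A) \<partial>\<nu>) = (\<integral>\<^sup>+A. g A \<partial>\<nu>)"
proof -
  have sets: "sets \<nu> = sets (restrict_space borel SO)"
    using haar by (simp add: normalized_haar_SO_def)
  have "(\<lambda>A. B ** A) \<in> borel \<rightarrow>\<^sub>M borel"
    unfolding matrix_matrix_mult_def by (intro borel_measurable_continuous_onI continuous_intros)
  then have "(\<lambda>A. B ** A) \<in> \<nu> \<rightarrow>\<^sub>M restrict_space borel SO"
    using B by (intro measurable_restrict_space2 normalized_haar_SO_measurable[OF haar])
      (auto simp: normalized_haar_SO_space[OF haar] SO_def rotation_matrix_def orthogonal_matrix_mul det_mul)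
  then have [measurable]: "(\<lambda>A. B ** A) \<in> \<nu> \<rightarrow>\<^sub>M \<nu>"
    using measurable_cong_sets[OF refl sets, of \<nu>] by blast
  have [measurable]: "g \<in> borel_measurable \<nu>"
    by (rule normalized_haar_SO_measurable[OF haar g])
  have "(\<integral>\<^sup>+A. g A \<partial>\<nu>) = (\<integral>\<^sup>+A. g A \<partial>distr \<nu> \<nu> (\<lambda>A. B ** A))"
    using haar B by (simp add: normalized_haar_SO_def)
  also have "\<dots> = (\<integral>\<^sup>+A. g (B ** A) \<partial>\<nu>)"
    by (rule nn_integral_distr) auto
  finally show ?thesis ..
qed

text \<open>Averaging \<open>g (A\<^sup>T B u)\<close> over both \<open>A\<close> and \<open>B\<close> passes from the left-invariant law to its
  image under inversion. The latter depends only on the norm of \<open>u\<close>, because left invariance turns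
  into right invariance.\<close>

lemma haar_orbit_transpose:
  fixes \<nu> :: "(real^'d::finite^'d) measure" and g :: "real^'d \<Rightarrow> ennreal"
  assumes haar: "normalized_haar_SO \<nu>" and [measurable]: "g \<in> borel_measurable borel"
  shows "(\<integral>\<^sup>+A. g (A *v u) \<partial>\<nu>) = (\<integral>\<^sup>+A. g (transpose A *v u) \<partial>\<nu>)"
    and "B \<in> SO \<Longrightarrow> (\<integral>\<^sup>+A. g (transpose A *v (B *v u)) \<partial>\<nu>) = (\<integral>\<^sup>+A. g (transpose A *v u) \<partial>\<nu>)"
proof -
  interpret prob_space \<nu> using haar by (simp add: normalized_haar_SO_def)
  interpret pair_sigma_finite \<nu> \<nu> ..
  have [measurable]: "(\<lambda>A. A) \<in> borel_measurable \<nu>"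
    by (rule normalized_haar_SO_measurable[OF haar]) simp
  have [measurable]: "fst \<in> borel_measurable (\<nu> \<Otimes>\<^sub>M \<nu>)" "snd \<in> borel_measurable (\<nu> \<Otimes>\<^sub>M \<nu>)"
    using measurable_compose[OF measurable_fst, of "\<lambda>A. A" \<nu> borel \<nu>]
          measurable_compose[OF measurable_snd, of "\<lambda>A. A" \<nu> borel \<nu>] by auto
  have right: "(\<integral>\<^sup>+A. g (transpose A *v (B *v u)) \<partial>\<nu>) = (\<integral>\<^sup>+A. g (transpose A *v u) \<partial>\<nu>)"
    if B: "B \<in> SO" for B
  proof -
    have "(\<lambda>A. g (transpose A *v u)) \<in> borel_measurable borel"
      by measurable
    \<comment> \<open>Left multiplication of \<open>A\<close> by \<open>transpose B\<close> becomes
      right multiplication by \<open>B\<close> once the product is transposed.\<close>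
    from normalized_haar_SO_invariant[OF haar SO_transpose[OF B] this]
    show ?thesis
      by (simp only: matrix_transpose_mul transpose_transpose matrix_vector_mul_assoc)
  qed
  show "B \<in> SO \<Longrightarrow> (\<integral>\<^sup>+A. g (transpose A *v (B *v u)) \<partial>\<nu>) = (\<integral>\<^sup>+A. g (transpose A *v u) \<partial>\<nu>)"
    by (rule right)
  \<comment> \<open>A dummy average over a second rotation is free, because \<open>\<nu>\<close> has
    mass one.\<close>
  have "(\<integral>\<^sup>+A. g (A *v u) \<partial>\<nu>) = (\<integral>\<^sup>+A. \<integral>\<^sup>+B. g (B *v u) \<partial>\<nu> \<partial>\<nu>)"
    by (simp add: emeasure_space_1)
  also have "\<dots> = (\<integral>\<^sup>+A. \<integral>\<^sup>+B. g (transpose A *v (B *v u)) \<partial>\<nu> \<partial>\<nu>)"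
  proof (rule nn_integral_cong)
    fix A assume "A \<in> space \<nu>"
    then have "transpose A \<in> SO"
      by (simp add: normalized_haar_SO_space[OF haar] SO_transpose)
    from normalized_haar_SO_invariant[OF haar this, of "\<lambda>A. g (A *v u)"]
    show "(\<integral>\<^sup>+B. g (B *v u) \<partial>\<nu>) = (\<integral>\<^sup>+B. g (transpose A *v (B *v u)) \<partial>\<nu>)"
      by (simp add: matrix_vector_mul_assoc)
  qed
  also have "\<dots> = (\<integral>\<^sup>+B. \<integral>\<^sup>+A. g (transpose A *v (B *v u)) \<partial>\<nu> \<partial>\<nu>)"
    by (rule Fubini') measurable
  also have "\<dots> = (\<integral>\<^sup>+B. \<integral>\<^sup>+A. g (transpose A *v u) \<partial>\<nu> \<partial>\<nu>)"
    by (rule nn_integral_cong, rule right) (simp add: normalized_haar_SO_space[OF haar])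
  also have "\<dots> = (\<integral>\<^sup>+A. g (transpose A *v u) \<partial>\<nu>)"
    by (simp add: emeasure_space_1)
  finally show "(\<integral>\<^sup>+A. g (A *v u) \<partial>\<nu>) = (\<integral>\<^sup>+A. g (transpose A *v u) \<partial>\<nu>)" .
qed

text \<open>By transitivity the orbit integral is the same at almost every \<open>\<theta>\<close>
  as at \<open>u\<close>, so it may be averaged over the sphere. After exchanging the integrals,
  rotation invariance of \<open>sphere_measure\<close> removes \<open>A\<close>.\<close>

lemma nn_integral_haar_orbit_unit:
  fixes \<nu> :: "(real^'d::finite^'d) measure" and g :: "real^'d \<Rightarrow> ennreal"
  assumes dim: "CARD('d) \<ge> 2" and haar: "normalized_haar_SO \<nu>"
    and g[measurable]: "g \<in> borel_measurable borel" and u: "norm u = 1"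
  shows "(\<integral>\<^sup>+A. g (A *v u) \<partial>\<nu>) = (\<integral>\<^sup>+\<theta>. g \<theta> \<partial>sphere_measure)"
proof -
  interpret N: prob_space \<nu> using haar by (simp add: normalized_haar_SO_def)
  interpret S: prob_space "sphere_measure :: (real^'d) measure"
    by (rule prob_space_sphere_measure)
  interpret pair_sigma_finite \<nu> "sphere_measure :: (real^'d) measure" ..
  have [measurable]: "(\<lambda>A. A) \<in> borel_measurable \<nu>"
    by (rule normalized_haar_SO_measurable[OF haar]) simp
  have [measurable]: "fst \<in> borel_measurable (\<nu> \<Otimes>\<^sub>M (sphere_measure :: (real^'d) measure))"
    using measurable_compose[OF measurable_fst, of "\<lambda>A. A" \<nu> borel] by auto
  have "(\<integral>\<^sup>+A. g (A *v u) \<partial>\<nu>) = (\<integral>\<^sup>+\<theta>. \<integral>\<^sup>+A. g (A *v u) \<partial>\<nu> \<partial>(sphere_measure :: (real^'d) measure))"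
    using S.emeasure_space_1 by simp
  also have "\<dots> = (\<integral>\<^sup>+\<theta>. \<integral>\<^sup>+A. g (A *v \<theta>) \<partial>\<nu> \<partial>sphere_measure)"
  proof (rule nn_integral_cong_AE)
    show "AE \<theta> in sphere_measure. (\<integral>\<^sup>+A. g (A *v u) \<partial>\<nu>) = (\<integral>\<^sup>+A. g (A *v \<theta>) \<partial>\<nu>)"
      using AE_sphere_measure_norm
    proof eventually_elim
      fix \<theta> :: "real^'d" assume "norm \<theta> = 1"
      then obtain B where B: "B \<in> SO" "B *v u = \<theta>"
        using SO_transitive[OF dim, of u \<theta>] u by auto
      show "(\<integral>\<^sup>+A. g (A *v u) \<partial>\<nu>) = (\<integral>\<^sup>+A. g (A *v \<theta>) \<partial>\<nu>)"
        \<comment> \<open>Pass to the transposed form at \<open>\<theta>\<close>, replace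
          \<open>B *v u\<close> by \<open>u\<close> there, and pass back.\<close>
        using haar_orbit_transpose[OF haar g] B by metis
    qed
  qed
  also have "\<dots> = (\<integral>\<^sup>+A. \<integral>\<^sup>+\<theta>. g (A *v \<theta>) \<partial>sphere_measure \<partial>\<nu>)"
    by (rule Fubini') measurable
  also have "\<dots> = (\<integral>\<^sup>+A. \<integral>\<^sup>+\<theta>. g \<theta> \<partial>sphere_measure \<partial>\<nu>)"
  proof (rule nn_integral_cong)
    fix A assume "A \<in> space \<nu>"
    then have T: "orthogonal_transformation ((*v) A)"
      by (simp add: normalized_haar_SO_space[OF haar] SO_orthogonal_transformation)
    have "(\<integral>\<^sup>+\<theta>. g \<theta> \<partial>sphere_measure) = (\<integral>\<^sup>+\<theta>. g \<theta> \<partial>distr sphere_measure borel ((*v) A))"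
      by (simp add: sphere_measure_distr_orthogonal[OF T])
    also have "\<dots> = (\<integral>\<^sup>+\<theta>. g (A *v \<theta>) \<partial>sphere_measure)"
      by (rule nn_integral_distr) auto
    finally show "(\<integral>\<^sup>+\<theta>. g (A *v \<theta>) \<partial>sphere_measure) = (\<integral>\<^sup>+\<theta>. g \<theta> \<partial>sphere_measure)" ..
  qed
  also have "\<dots> = (\<integral>\<^sup>+\<theta>. g \<theta> \<partial>sphere_measure)"
    by (simp add: N.emeasure_space_1)
  finally show ?thesis .
qed

lemma nn_integral_haar_orbit:
  fixes \<nu> :: "(real^'d::finite^'d) measure" and g :: "real^'d \<Rightarrow> ennreal"
  assumes dim: "CARD('d) \<ge> 2" and haar: "normalized_haar_SO \<nu>"
    and g[measurable]: "g \<in> borel_measurable borel"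
  shows "(\<integral>\<^sup>+A. g (A *v v) \<partial>\<nu>) = (\<integral>\<^sup>+\<theta>. g (norm v *\<^sub>R \<theta>) \<partial>sphere_measure)"
proof -
  obtain u :: "real^'d" where u: "norm u = 1" "v = norm v *\<^sub>R u"
  proof (cases "v = 0")
    \<comment> \<open>At the origin any unit vector will do, as it is multiplied by
      \<open>norm v = 0\<close>; a coordinate vector in an arbitrary direction is taken.\<close>
    case True
    then show ?thesis
      using that[of "axis undefined 1"] by simp
  next
    case False
    then show ?thesis
      using that[of "v /\<^sub>R norm v"] by simp
  qed
  have "(\<integral>\<^sup>+A. g (A *v v) \<partial>\<nu>) = (\<integral>\<^sup>+A. g (norm v *\<^sub>R (A *v u)) \<partial>\<nu>)"
    by (subst u(2)) (simp add: matrix_vector_mult_scaleR)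
  also have "\<dots> = (\<integral>\<^sup>+\<theta>. g (norm v *\<^sub>R \<theta>) \<partial>sphere_measure)"
    by (rule nn_integral_haar_orbit_unit[OF dim haar _ u(1)]) measurable
  finally show ?thesis .
qed

subsection \<open>Radial laws and the cost\<close>

lemma sets_radial_law[simp, measurable_cong]: "sets (radial_law f) = sets borel"
  by (simp add: radial_law_def)

lemma AE_radial_law_nonneg:
  assumes [measurable]: "f \<in> borel_measurable borel"
  shows "AE r in radial_law f. 0 \<le> r"
  unfolding radial_law_def by (subst AE_density) (auto split: split_indicator)

lemma nn_integral_polar_measure:
  fixes g :: "real^'d::finite \<Rightarrow> ennreal"
  assumes [measurable]: "g \<in> borel_measurable borel"
  shows "(\<integral>\<^sup>+x. g x \<partial>polar_measure f)
       = (\<integral>\<^sup>+r. \<integral>\<^sup>+\<theta>. g (r *\<^sub>R \<theta>) \<partial>sphere_measure \<partial>radial_law f)"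
proof -
  interpret S: prob_space "sphere_measure :: (real^'d) measure"
    by (rule prob_space_sphere_measure)
  show ?thesis
    unfolding polar_measure_def
    by (subst nn_integral_distr; (simp add: S.nn_integral_fst[symmetric] case_prod_beta)?)
qed

text \<open>The norm of \<open>r *\<^sub>R \<theta>\<close> is \<open>r\<close> as soon as
  \<open>r\<close> is nonnegative and \<open>\<theta>\<close> is a unit vector, and both hold almost
  everywhere.\<close>

lemma distr_norm_polar_measure:
  assumes [measurable]: "f \<in> borel_measurable borel"
  shows "distr (polar_measure f :: (real^'d::finite) measure) borel norm = radial_law f"
proof (rule measure_eqI)
  interpret S: prob_space "sphere_measure :: (real^'d) measure"
    by (rule prob_space_sphere_measure)
  fix E assume "E \<in> sets (distr (polar_measure f :: (real^'d) measure) borel norm)"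
  then have [measurable]: "E \<in> sets borel" by simp
  have [measurable_cong]: "sets (polar_measure f :: (real^'d) measure) = sets borel"
    by (simp add: polar_measure_def)
  have "emeasure (distr (polar_measure f :: (real^'d) measure) borel norm) E
      = (\<integral>\<^sup>+x. indicator E x \<partial>distr (polar_measure f :: (real^'d) measure) borel norm)"
    by simp
  also have "\<dots> = (\<integral>\<^sup>+x. indicator E (norm x) \<partial>(polar_measure f :: (real^'d) measure))"
    by (rule nn_integral_distr) measurable
  also have "\<dots> = (\<integral>\<^sup>+r. \<integral>\<^sup>+\<theta>. indicator E (norm (r *\<^sub>R (\<theta>::real^'d))) \<partial>sphere_measure \<partial>radial_law f)"
    by (rule nn_integral_polar_measure) measurable
  also have "\<dots> = (\<integral>\<^sup>+r. indicator E r \<partial>radial_law f)"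
  proof (rule nn_integral_cong_AE)
    show "AE r in radial_law f.
      (\<integral>\<^sup>+\<theta>. indicator E (norm (r *\<^sub>R (\<theta>::real^'d))) \<partial>sphere_measure) = (indicator E r :: ennreal)"
      using AE_radial_law_nonneg[OF assms]
    proof eventually_elim
      fix r :: real assume "0 \<le> r"
      then have "AE \<theta> in sphere_measure.
          indicator E (norm (r *\<^sub>R (\<theta>::real^'d))) = (indicator E r :: ennreal)"
        using AE_sphere_measure_norm by (auto elim!: AE_mp)
      then have "(\<integral>\<^sup>+\<theta>. indicator E (norm (r *\<^sub>R (\<theta>::real^'d))) \<partial>sphere_measure)
          = (\<integral>\<^sup>+\<theta>. indicator E r \<partial>(sphere_measure :: (real^'d) measure))"
        by (rule nn_integral_cong_AE)
      then show "(\<integral>\<^sup>+\<theta>. indicator E (norm (r *\<^sub>R (\<theta>::real^'d))) \<partial>sphere_measure)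
          = (indicator E r :: ennreal)"
        using S.emeasure_space_1 by simp
    qed
  qed
  also have "\<dots> = emeasure (radial_law f) E"
    by simp
  finally show "emeasure (distr (polar_measure f :: (real^'d) measure) borel norm) E
      = emeasure (radial_law f) E" .
qed simp

section \<open>The Coulomb cost under rotations\<close>

lemma coulomb_cost_measurable[measurable]:
  "coulomb_cost \<in> borel_measurable (borel :: (real^'d::finite^'n::finite) measure)"
  unfolding coulomb_cost_def case_prod_beta by measurable

lemma coulomb_cost_rotate:
  assumes "A \<in> SO"
  shows "coulomb_cost (\<chi> i. A *v (x $ i)) = coulomb_cost x"
  using SO_orthogonal_transformation[OF assms]
  by (simp add: coulomb_cost_def matrix_vector_mult_diff_distrib[symmetric] orthogonal_transformation_norm)

lemma rotate_measurable:
  assumes "normalized_haar_SO \<nu>"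
  shows "(\<lambda>A. \<chi> i. A *v (x $ i)) \<in> borel_measurable \<nu>"
  by (intro normalized_haar_SO_measurable[OF assms] borel_measurable_continuous_onI)
    (unfold matrix_vector_mult_def, intro continuous_intros)

lemma nn_integral_rotation_law:
  assumes "normalized_haar_SO \<nu>" "g \<in> borel_measurable borel"
  shows "(\<integral>\<^sup>+y. g y \<partial>rotation_law \<nu> x) = (\<integral>\<^sup>+A. g (\<chi> i. A *v (x $ i)) \<partial>\<nu>)"
  unfolding rotation_law_def using assms
  by (intro nn_integral_distr rotate_measurable) auto

text \<open>The cost is constant along the orbit of \<open>x\<close>, and \<open>\<nu>\<close> has
  mass one.\<close>

lemma nn_integral_coulomb_cost_rotation_law:
  assumes haar: "normalized_haar_SO \<nu>"
  shows "(\<integral>\<^sup>+y. coulomb_cost y \<partial>rotation_law \<nu> x) = coulomb_cost x"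
proof -
  interpret prob_space \<nu> using haar by (simp add: normalized_haar_SO_def)
  have "(\<integral>\<^sup>+y. coulomb_cost y \<partial>rotation_law \<nu> x)
      = (\<integral>\<^sup>+A. coulomb_cost (\<chi> i. A *v (x $ i)) \<partial>\<nu>)"
    by (rule nn_integral_rotation_law[OF haar]) measurable
  also have "\<dots> = (\<integral>\<^sup>+A. coulomb_cost x \<partial>\<nu>)"
    by (intro nn_integral_cong coulomb_cost_rotate) (simp add: normalized_haar_SO_space[OF haar])
  finally show ?thesis
    by (simp add: emeasure_space_1)
qed

text \<open>Without measurability of \<open>g\<close> only this inequality holds; it spares a proof that the reduced
  cost is measurable.\<close>

lemma nn_integral_distr_le:
  assumes T: "T \<in> M \<rightarrow>\<^sub>M M'"
  shows "integral\<^sup>N (distr M M' T) g \<le> (\<integral>\<^sup>+x. g (T x) \<partial>M)"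
  unfolding nn_integral_def[of "distr M M' T"]
proof (rule SUP_least)
  fix s assume s: "s \<in> {s. simple_function (distr M M' T) s \<and> s \<le> g}"
  then have "integral\<^sup>S (distr M M' T) s = integral\<^sup>N (distr M M' T) s"
    by (simp add: nn_integral_eq_simple_integral)
  \<comment> \<open>The simple function \<open>s\<close> is measurable, so the change of variables
    is an equality for it.\<close>
  also have "\<dots> = (\<integral>\<^sup>+x. s (T x) \<partial>M)"
    using s by (intro nn_integral_distr[OF T] borel_measurable_simple_function) simp
  also have "\<dots> \<le> (\<integral>\<^sup>+x. g (T x) \<partial>M)"
    using s by (intro nn_integral_mono) (auto simp: le_fun_def)
  finally show "integral\<^sup>S (distr M M' T) s \<le> (\<integral>\<^sup>+x. g (T x) \<partial>M)" .
qed

section \<open>The radii of a coupling and the lower bound\<close>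

lemma radii_measurable[measurable]:
  "(\<lambda>y::real^'d::finite^'n::finite. \<chi> i. norm (y $ i)) \<in> borel_measurable borel"
  by (intro borel_measurable_continuous_onI continuous_intros)

text \<open>Taking norms commutes with projecting to a particle. This makes the radii of any
  coupling a competitor in the reduced problem.\<close>

lemma couplings_radii:
  fixes P :: "(real^'d::finite^'n::finite) measure"
  assumes f: "f \<in> borel_measurable borel" and P: "P \<in> couplings (polar_measure f)"
  shows "distr P borel (\<lambda>y. \<chi> i. norm (y $ i)) \<in> couplings (radial_law f)"
proof -
  interpret prob_space P using P by (simp add: couplings_def)
  have [measurable_cong]: "sets P = sets borel"
    and marginal: "distr P borel (\<lambda>y. y $ i) = polar_measure f" for i
    using P by (simp_all add: couplings_def)
  have "distr (distr P borel (\<lambda>y. \<chi> i. norm (y $ i))) borel (\<lambda>r. r $ i) = radial_law f" for i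
  proof -
    have "distr (distr P borel (\<lambda>y. \<chi> i. norm (y $ i))) borel (\<lambda>r. r $ i)
        = distr P borel (\<lambda>y. norm (y $ i))"
      by (subst distr_distr) (auto simp: o_def)
    also have "\<dots> = distr (distr P borel (\<lambda>y. y $ i)) borel norm"
      by (subst distr_distr) (auto simp: o_def)
    finally show ?thesis
      by (simp add: marginal distr_norm_polar_measure[OF f])
  qed
  then show ?thesis
    by (simp add: couplings_def prob_space_distr)
qed

text \<open>Each configuration is itself admissible in the infimum that defines the reduced cost of
  its radii.\<close>

lemma reduced_cost_le_total_cost:
  fixes P :: "(real^'d::finite^'n::finite) measure"
  assumes [measurable_cong]: "sets P = sets borel"
  shows "(\<integral>\<^sup>+r. reduced_cost TYPE('d) r \<partial>distr P borel (\<lambda>y. \<chi> i. norm (y $ i))) \<le> total_cost P"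
proof -
  have "(\<integral>\<^sup>+r. reduced_cost TYPE('d) r \<partial>distr P borel (\<lambda>y. \<chi> i. norm (y $ i)))
      \<le> (\<integral>\<^sup>+y. reduced_cost TYPE('d) (\<chi> i. norm (y $ i)) \<partial>P)"
    by (rule nn_integral_distr_le) measurable
  also have "\<dots> \<le> total_cost P"
    unfolding total_cost_def reduced_cost_def by (intro nn_integral_mono INF_lower) simp
  finally show ?thesis .
qed

text \<open>Negative radii, for which no configuration exists, can be ignored: every marginal lives
  on the half-line, and there are finitely many.\<close>

lemma AE_couplings_nonneg:
  fixes \<gamma> :: "(real^'n::finite) measure"
  assumes f: "f \<in> borel_measurable borel" and \<gamma>: "\<gamma> \<in> couplings (radial_law f)"
  shows "AE r in \<gamma>. \<forall>i. 0 \<le> r $ i"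
proof -
  have [measurable_cong]: "sets \<gamma> = sets borel"
    and marginal: "distr \<gamma> borel (\<lambda>r. r $ i) = radial_law f" for i
    using \<gamma> by (simp_all add: couplings_def)
  have "AE r in \<gamma>. 0 \<le> r $ i" for i
    using AE_radial_law_nonneg[OF f] unfolding marginal[of i, symmetric] by (subst (asm) AE_distr_iff) auto
  then show ?thesis
    by (simp add: AE_all_countable)
qed

section \<open>Marginals, cost and optimality of the glued measure\<close>

text \<open>A selection of minimizers need not be Borel, so the kernel is taken measurable with
  respect to \<open>completion \<gamma>\<close> only.\<close>

theorem theorem3p0p1:
  fixes \<rho> :: "(real^'d::finite) measure"
    and f :: "real \<Rightarrow> ennreal"
    and \<gamma> :: "(real^'n::finite) measure"
    and \<nu> :: "(real^'d^'d) measure"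
    and x :: "real^'n \<Rightarrow> real^'d^'n"
    and \<rho>\<^sub>N :: "(real^'d^'n) measure"
  assumes dim: "CARD('d) \<ge> 2"
    and prob: "prob_space \<rho>"
    and f_meas: "f \<in> borel_measurable borel"
    and radial: "\<rho> = polar_measure f"
    and minimizer: "is_arg_min (\<lambda>\<gamma>. \<integral>\<^sup>+ r. reduced_cost TYPE('d) r \<partial>\<gamma>)
                      (\<lambda>\<gamma>. \<gamma> \<in> couplings (radial_law f)) \<gamma>"
    and haar: "normalized_haar_SO \<nu>"
    and selection: "\<And>r. (\<And>i. 0 \<le> r $ i) \<Longrightarrow>
                      (\<forall>i. norm (x r $ i) = r $ i) \<and> coulomb_cost (x r) = reduced_cost TYPE('d) r"
    and kernel: "(\<lambda>r. rotation_law \<nu> (x r)) \<in> completion \<gamma> \<rightarrow>\<^sub>M prob_algebra borel"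
    and \<rho>\<^sub>N_def: "\<rho>\<^sub>N = completion \<gamma> \<bind> (\<lambda>r. rotation_law \<nu> (x r))"
  shows "\<rho>\<^sub>N \<in> couplings \<rho> \<and> total_cost \<rho>\<^sub>N = optimal_cost TYPE('n) \<rho>"
proof -
  have \<gamma>: "\<gamma> \<in> couplings (radial_law f)"
    and min: "\<gamma>' \<in> couplings (radial_law f) \<Longrightarrow>
      (\<integral>\<^sup>+r. reduced_cost TYPE('d) r \<partial>\<gamma>) \<le> (\<integral>\<^sup>+r. reduced_cost TYPE('d) r \<partial>\<gamma>')" for \<gamma>' :: "(real^'n) measure"
    using minimizer unfolding is_arg_min_def by (auto simp: not_less)
  interpret G: prob_space \<gamma> using \<gamma> by (simp add: couplings_def)
  interpret C: prob_space "completion \<gamma>"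
    by (rule prob_spaceI) (simp add: G.emeasure_space_1)
  interpret S: prob_space "sphere_measure :: (real^'d) measure"
    by (rule prob_space_sphere_measure)
  have [measurable_cong]: "sets \<gamma> = sets borel"
    and marginal: "distr \<gamma> borel (\<lambda>r. r $ i) = radial_law f" for i
    using \<gamma> by (simp_all add: couplings_def)
  note K = measurable_prob_algebraD[OF kernel]
  have AE_nonneg: "AE r in \<gamma>. \<forall>i. 0 \<le> r $ i"
    by (rule AE_couplings_nonneg[OF f_meas \<gamma>])
  \<comment> \<open>The completion disappears here: nonnegative integrals against it and against
    \<open>\<gamma>\<close> agree.\<close>
  have int_\<rho>\<^sub>N: "(\<integral>\<^sup>+y. g y \<partial>\<rho>\<^sub>N) = (\<integral>\<^sup>+r. \<integral>\<^sup>+y. g y \<partial>rotation_law \<nu> (x r) \<partial>\<gamma>)"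
    if "g \<in> borel_measurable borel" for g
    unfolding \<rho>\<^sub>N_def by (simp add: nn_integral_bind[OF that K] nn_integral_completion)
  have sets_\<rho>\<^sub>N[measurable_cong]: "sets \<rho>\<^sub>N = sets borel"
    unfolding \<rho>\<^sub>N_def by (rule sets_bind) (auto simp: rotation_law_def G.not_empty)
  have prob_\<rho>\<^sub>N: "prob_space \<rho>\<^sub>N"
    unfolding \<rho>\<^sub>N_def using measurable_space[OF kernel]
    by (intro C.prob_space_bind[OF _ K] AE_I2) (simp add: space_prob_algebra)
  have "distr \<rho>\<^sub>N borel (\<lambda>y. y $ i) = \<rho>" for i
  proof (rule measure_eqI)
    fix E assume "E \<in> sets (distr \<rho>\<^sub>N borel (\<lambda>y. y $ i))"
    then have [measurable]: "E \<in> sets borel" by simp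
    let ?e = "indicator E :: real^'d \<Rightarrow> ennreal"
    have "emeasure (distr \<rho>\<^sub>N borel (\<lambda>y. y $ i)) E = (\<integral>\<^sup>+y. ?e y \<partial>distr \<rho>\<^sub>N borel (\<lambda>y. y $ i))"
      by simp
    also have "\<dots> = (\<integral>\<^sup>+y. ?e (y $ i) \<partial>\<rho>\<^sub>N)"
      by (rule nn_integral_distr) measurable
    also have "\<dots> = (\<integral>\<^sup>+r. \<integral>\<^sup>+y. ?e (y $ i) \<partial>rotation_law \<nu> (x r) \<partial>\<gamma>)"
      by (rule int_\<rho>\<^sub>N) measurable
    \<comment> \<open>Given the radii, particle \<open>i\<close> is a Haar-random rotation of a
      point of norm \<open>r $ i\<close>, hence uniform on the sphere of that radius.\<close>
    also have "\<dots> = (\<integral>\<^sup>+r. \<integral>\<^sup>+\<theta>. ?e (r $ i *\<^sub>R \<theta>) \<partial>sphere_measure \<partial>\<gamma>)"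
    proof (rule nn_integral_cong_AE)
      show "AE r in \<gamma>. (\<integral>\<^sup>+y. ?e (y $ i) \<partial>rotation_law \<nu> (x r))
          = (\<integral>\<^sup>+\<theta>. ?e (r $ i *\<^sub>R \<theta>) \<partial>sphere_measure)"
        using AE_nonneg
      proof eventually_elim
        fix r :: "real^'n" assume "\<forall>i. 0 \<le> r $ i"
        then have "norm (x r $ i) = r $ i"
          using selection by blast
        then show "(\<integral>\<^sup>+y. ?e (y $ i) \<partial>rotation_law \<nu> (x r))
            = (\<integral>\<^sup>+\<theta>. ?e (r $ i *\<^sub>R \<theta>) \<partial>sphere_measure)"
          using nn_integral_haar_orbit[OF dim haar, of ?e "x r $ i"]
          by (simp add: nn_integral_rotation_law[OF haar])
      qed
    qed
    \<comment> \<open>The integrand sees only the coordinate \<open>r $ i\<close>, so only the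
      marginal of \<open>\<gamma>\<close> matters, and the result is \<open>polar_measure f\<close>
      in polar coordinates.\<close>
    also have "\<dots> = (\<integral>\<^sup>+s. \<integral>\<^sup>+\<theta>. ?e (s *\<^sub>R \<theta>) \<partial>sphere_measure \<partial>distr \<gamma> borel (\<lambda>r. r $ i))"
      by (rule nn_integral_distr[symmetric]) measurable
    also have "\<dots> = (\<integral>\<^sup>+y. ?e y \<partial>polar_measure f)"
      unfolding marginal by (rule nn_integral_polar_measure[symmetric]) measurable
    also have "\<dots> = emeasure \<rho> E"
      unfolding radial by (rule nn_integral_indicator) (simp add: polar_measure_def)
    finally show "emeasure (distr \<rho>\<^sub>N borel (\<lambda>y. y $ i)) E = emeasure \<rho> E" .
  qed (simp add: radial polar_measure_def)
  then have \<rho>\<^sub>N: "\<rho>\<^sub>N \<in> couplings \<rho>"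
    using prob_\<rho>\<^sub>N sets_\<rho>\<^sub>N by (simp add: couplings_def)
  have "total_cost \<rho>\<^sub>N = (\<integral>\<^sup>+r. coulomb_cost (x r) \<partial>\<gamma>)"
    unfolding total_cost_def by (simp add: int_\<rho>\<^sub>N nn_integral_coulomb_cost_rotation_law[OF haar])
  \<comment> \<open>At almost every \<open>r\<close> the selected configuration attains the reduced
    cost.\<close>
  also have "\<dots> = (\<integral>\<^sup>+r. reduced_cost TYPE('d) r \<partial>\<gamma>)"
    using AE_nonneg by (intro nn_integral_cong_AE) (auto simp: selection elim!: AE_mp)
  finally have cost: "total_cost \<rho>\<^sub>N = (\<integral>\<^sup>+r. reduced_cost TYPE('d) r \<partial>\<gamma>)" .
  \<comment> \<open>Minimality of \<open>\<gamma>\<close> is tested against the law of the radii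
    under \<open>P\<close>, whose reduced cost is at most \<open>total_cost P\<close>.\<close>
  have "total_cost \<rho>\<^sub>N \<le> total_cost P" if "P \<in> couplings \<rho>" for P :: "(real^'d^'n) measure"
    unfolding cost using min[OF couplings_radii[OF f_meas that[unfolded radial]]] that
    by (intro order_trans[OF _ reduced_cost_le_total_cost]) (auto simp: couplings_def)
  then have "total_cost \<rho>\<^sub>N = optimal_cost TYPE('n) \<rho>"
    unfolding optimal_cost_def using \<rho>\<^sub>N by (intro antisym INF_greatest INF_lower)
  with \<rho>\<^sub>N show ?thesis ..
qed

end
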